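(* Let $X$ be a compactum and let $\mu$ be a non-atomic semifinite Borel measure on $X$ such that the collection $\{K\in K(X):\mu(K)=0\}$ of compact $\mu$-null sets is coanalytic in $K(X)$. If $\mu$ is not $\sigma$-finite, then there is a $G_{\delta\sigma}$-set $M$ in $X$ such that: (i) there is no $G_\delta$-set $G$ in $X$ with $M\subseteq G$ and $\mu(G\setminus M)=0$; (ii) there is a semifinite Borel measure $\mu'\ll\mu$ on $X$ such that $\mu'(M)=0$ but $M$ is not contained in any $\mu'$-null $G_\delta$-set in $X$.
   Context: A compactum is a compact metrizable space. $K(X)$ denotes the space of compact subsets of $X$ with the Vietoris topology. A Borel measure $\mu$ on $X$ (a countably additive measure on the Borel $\sigma$-algebra with values in $[0,+\infty]$) is semifinite if each Borel set of positive $\mu$-measure contains a Borel set of finite positive $\mu$-measure. Non-atomic means that all singletons have measure zero. A $G_{\delta\sigma}$-set is a countable union of $G_\delta$-sets. $\mu'\ll\mu$ means that $\mu(B)=0$ implies $\mu'(B)=0$ for Borel sets $B$. *)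

theory Defs
  imports "HOL-Analysis.Analysis"
begin

text \<open>
  The space \<open>K(X)\<close> of compact subsets of \<open>X\<close>; the empty set is one of its points.
\<close>

definition vietoris :: "'a::topological_space set topology" where
  "vietoris = topology_generated_by
     ({{K. compact K \<and> K \<subseteq> U} |U. open U} \<union> {{K. compact K \<and> K \<inter> U \<noteq> {}} |U. open U})"

lemma topspace_vietoris [simp]: "topspace vietoris = {K. compact K}"
  unfolding vietoris_def by (auto intro!: exI[of _ "{K. compact K \<and> K \<subseteq> UNIV}"])

text \<open>
  Analytic subsets of a Polish space: the continuous images of the Baire space
  \<open>nat \<Rightarrow> nat\<close> (with the product of the discrete topologies), together with the empty set.
\<close>

definition analytic_in :: "'a topology \<Rightarrow> 'a set \<Rightarrow> bool" where
  "analytic_in T A \<longleftrightarrow>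
     A = {} \<or> (\<exists>f. continuous_map (euclidean :: (nat \<Rightarrow> nat) topology) T f \<and> range f = A)"

definition coanalytic_in :: "'a topology \<Rightarrow> 'a set \<Rightarrow> bool" where
  "coanalytic_in T A \<longleftrightarrow> A \<subseteq> topspace T \<and> analytic_in T (topspace T - A)"

text \<open>
  The library locale \<open>semifinite_measure\<close> is not used here: it does not require the subset
  of finite measure to have positive measure, hence it is satisfied by every measure.
\<close>

definition semifinite :: "'a measure \<Rightarrow> bool" where
  "semifinite M \<longleftrightarrow>
     (\<forall>B\<in>sets M. 0 < emeasure M B \<longrightarrow>
        (\<exists>C\<in>sets M. C \<subseteq> B \<and> 0 < emeasure M C \<and> emeasure M C < \<infinity>))"

definition gdelta_sigma_in :: "'a topology \<Rightarrow> 'a set \<Rightarrow> bool" where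
  "gdelta_sigma_in T = countable union_of gdelta_in T"

end

theory Submission
  imports Defs
begin

text \<open>
  A non-\<open>\<sigma>\<close>-finite semifinite measure admits an uncountable disjoint family of compact sets of
  positive measure. As the compact sets of positive measure form an analytic family and
  disjointness is an open relation on \<open>K(X)\<close>, a perfect set argument along a parametrization by
  the Baire space yields pairwise disjoint compact sets \<open>K x\<close> of positive measure that depend
  continuously on a point \<open>x\<close> of the Cantor space. Let \<open>M\<close> be the union of the \<open>K x\<close> over a
  countable dense set \<open>D\<close> of parameters. If a \<open>G\<^sub>\<delta>\<close>-set \<open>G\<close> contains \<open>M\<close>, then \<open>K x \<subseteq> G\<close> for
  comeagre many \<open>x\<close>, hence for some \<open>x\<close> outside \<open>D\<close>, and this \<open>K x\<close> is a subset of \<open>G - M\<close> of positive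
  measure. This proves (i), and (ii) follows with \<open>\<mu>' B = \<mu> (B - M)\<close>.
\<close>

section \<open>Uncountable families of compact sets of positive measure\<close>

text \<open>The sets with this approximation property form a Dynkin system containing the open sets,
  which are stable under intersection. Asking for \<open>F\<close> and \<open>U\<close> at once
  makes the property invariant under complements.\<close>

lemma borel_closed_open_approx:
  fixes N :: "'a::metric_space measure"
  assumes sets: "sets N = sets borel" and fin: "emeasure N UNIV < \<infinity>"
    and B: "B \<in> sets borel" and e: "0 < (e::real)"
  shows "\<exists>F U. closed F \<and> open U \<and> F \<subseteq> B \<and> B \<subseteq> U \<and> measure N (U - F) < e"
proof -
  have sp: "space N = UNIV"
    using sets_eq_imp_space_eq[OF sets] by simp
  interpret finite_measure N
    by (rule finite_measureI) (use fin sp in auto)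
  have "\<forall>e>0. \<exists>F U. closed F \<and> open U \<and> F \<subseteq> B \<and> B \<subseteq> U \<and> measure N (U - F) < e"
    (is "?P B")
  proof (rule sigma_sets_induct_disjoint[where P = ?P and G = "{S. open S}" and \<Omega> = UNIV])
    show "Int_stable {S::'a set. open S}"
      by (auto simp: Int_stable_def)
    show "B \<in> sigma_sets UNIV {S. open S}"
      using B by (simp add: borel_def)
    show "?P {}"
      by (intro allI impI exI[of _ "{}"]) auto
  next
    fix A :: "'a set" assume "A \<in> {S. open S}"
    then have "open A" by simp
    \<comment> \<open>In a metric space the closed set \<open>- A\<close> is a decreasing
      intersection of open \<open>C n\<close>, so the closed sets \<open>- C n\<close> exhaust
      \<open>A\<close> from inside.\<close>
    then have "gdelta_in euclidean (- A)"
      by (intro closed_imp_gdelta_in) (auto simp: metrizable_space_euclidean)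
    then obtain C where C: "\<And>n. open (C n)" "\<And>n. C (Suc n) \<subseteq> C n" "\<Inter> (range C) = - A"
      unfolding gdelta_in_descending by auto
    have "(\<lambda>n. measure N (A \<inter> C n)) \<longlonglongrightarrow> measure N (\<Inter>n. A \<inter> C n)"
      using C \<open>open A\<close> by (intro finite_Lim_measure_decseq) (auto simp: sets decseq_Suc_iff)
    moreover have "(\<Inter>n. A \<inter> C n) = {}"
      using C(3) by auto
    ultimately have lim: "(\<lambda>n. measure N (A \<inter> C n)) \<longlonglongrightarrow> 0"
      by simp
    show "?P A"
    proof (intro allI impI)
      fix e :: real assume "0 < e"
      with lim obtain n where "measure N (A \<inter> C n) < e"
        by (metis order_tendstoD(2) eventually_sequentially order_refl)
      moreover have "A - (- C n) = A \<inter> C n" "- C n \<subseteq> A"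
        using C(3) by auto
      ultimately show "\<exists>F U. closed F \<and> open U \<and> F \<subseteq> A \<and> A \<subseteq> U \<and> measure N (U - F) < e"
        using \<open>open A\<close> C(1) by (intro exI[of _ "- C n"] exI[of _ A]) (auto simp: closed_def)
    qed
  next
    fix A :: "'a set" assume P: "?P A"
    show "?P (UNIV - A)"
    proof (intro allI impI)
      fix e :: real assume "0 < e"
      with P obtain F U where FU: "closed F" "open U" "F \<subseteq> A" "A \<subseteq> U" "measure N (U - F) < e"
        by meson
      moreover have "- F - (- U) = U - F" by auto
      ultimately show "\<exists>F U. closed F \<and> open U \<and> F \<subseteq> UNIV - A \<and> UNIV - A \<subseteq> U \<and> measure N (U - F) < e"
        by (intro exI[of _ "- U"] exI[of _ "- F"]) auto
    qed
  next
    fix A :: "nat \<Rightarrow> 'a set"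
    assume A: "range A \<subseteq> sigma_sets UNIV {S. open S}" and P: "\<And>i. ?P (A i)"
    have Am: "A i \<in> sets N" for i
      using A by (auto simp: sets borel_def)
    show "?P (\<Union> (range A))"
    proof (intro allI impI)
      fix e :: real assume "0 < e"
      then have "\<forall>i. \<exists>F U. closed F \<and> open U \<and> F \<subseteq> A i \<and> A i \<subseteq> U \<and>
          measure N (U - F) < e / 2 * (1/2) ^ Suc i"
        by (intro allI P[rule_format]) simp
      then obtain F U where FU: "\<And>i. closed (F i)" "\<And>i. open (U i)" "\<And>i. F i \<subseteq> A i"
          "\<And>i. A i \<subseteq> U i" "\<And>i. measure N (U i - F i) < e / 2 * (1/2) ^ Suc i"
        by metis
      have meas: "F i \<in> sets N" "U i \<in> sets N" for i
        using FU(1,2) by (auto simp: sets)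
      have sm: "(\<lambda>i. e / 2 * (1/2) ^ Suc i) sums (e / 2)"
        using sums_mult[OF power_half_series, of "e/2"] by simp
      have su: "summable (\<lambda>i. measure N (U i - F i))"
        by (rule summable_comparison_test'[OF sums_summable[OF sm], of 0])
           (use FU(5) in \<open>auto intro: less_imp_le\<close>)
      have "measure N (\<Union>i. U i - F i) \<le> (\<Sum>i. measure N (U i - F i))"
        using su meas by (intro finite_measure_subadditive_countably) auto
      also have "\<dots> \<le> (\<Sum>i. e / 2 * (1/2) ^ Suc i)"
        by (rule suminf_le[OF less_imp_le[OF FU(5)] su sums_summable[OF sm]])
      also have "\<dots> = e / 2"
        using sm by (simp add: sums_iff)
      finally have b1: "measure N (\<Union>i. U i - F i) \<le> e / 2" .
      \<comment> \<open>The full union of the \<open>F i\<close> need not be closed, so it is cut to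
        a finite one. The gaps \<open>U i - F i\<close> cost at most \<open>e / 2\<close>, and the
        lost part \<open>?L n\<close> decreases to the empty set, so it gets below the other
        half.\<close>
      let ?L = "\<lambda>n. (\<Union>i. F i) - (\<Union>i\<le>n. F i)"
      have "(\<lambda>n. measure N (?L n)) \<longlonglongrightarrow> measure N (\<Inter>n. ?L n)"
        using meas by (intro finite_Lim_measure_decseq) (auto simp: decseq_def)
      moreover have "(\<Inter>n. ?L n) = {}"
      proof (rule equals0I)
        fix x assume x: "x \<in> (\<Inter>n. ?L n)"
        then obtain i where "x \<in> F i" by blast
        moreover have "x \<in> ?L i" using x by blast
        ultimately show False by auto
      qed
      ultimately have "(\<lambda>n. measure N (?L n)) \<longlonglongrightarrow> 0"
        by (simp only: measure_empty)
      then obtain n where n: "measure N (?L n) < e / 2"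
        using order_tendstoD(2)[of _ 0 sequentially "e / 2"] \<open>0 < e\<close> eventually_happens by fastforce
      have "measure N ((\<Union>i. U i) - (\<Union>i\<le>n. F i)) \<le> measure N ((\<Union>i. U i - F i) \<union> ?L n)"
        using meas by (intro finite_measure_mono) auto
      also have "\<dots> \<le> measure N (\<Union>i. U i - F i) + measure N (?L n)"
        using meas by (intro measure_subadditive) (auto simp: emeasure_eq_measure)
      also have "\<dots> < e"
        using b1 n by simp
      finally have "measure N ((\<Union>i. U i) - (\<Union>i\<le>n. F i)) < e" .
      moreover have "closed (\<Union>i\<le>n. F i)" "open (\<Union>i. U i)"
        using FU(1,2) by auto
      moreover have "(\<Union>i\<le>n. F i) \<subseteq> \<Union> (range A)" "\<Union> (range A) \<subseteq> (\<Union>i. U i)"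
        using FU(3,4) by blast+
      ultimately show "\<exists>F U. closed F \<and> open U \<and> F \<subseteq> \<Union> (range A) \<and> \<Union> (range A) \<subseteq> U \<and>
          measure N (U - F) < e"
        by blast
    qed
  qed simp
  with e show ?thesis by blast
qed

text \<open>Restricting \<open>\<mu>\<close> to a subset \<open>C\<close> of finite positive measure
  gives a finite measure, to which closed approximation applies; closed sets are compact
  here.\<close>

lemma semifinite_imp_compact_subset:
  fixes \<mu> :: "'a::metric_space measure"
  assumes comp: "compact (UNIV :: 'a set)" and sets: "sets \<mu> = sets borel"
    and sf: "semifinite \<mu>" and B: "B \<in> sets borel" "0 < emeasure \<mu> B"
  shows "\<exists>K. compact K \<and> K \<subseteq> B \<and> 0 < emeasure \<mu> K \<and> emeasure \<mu> K < \<infinity>"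
proof -
  obtain C where C: "C \<in> sets borel" "C \<subseteq> B" "0 < emeasure \<mu> C" "emeasure \<mu> C < \<infinity>"
    using sf B unfolding semifinite_def sets by blast
  define N where "N = density \<mu> (indicator C)"
  have setsN: "sets N = sets borel"
    by (simp add: N_def sets)
  have emN: "emeasure N A = emeasure \<mu> (C \<inter> A)" if "A \<in> sets borel" for A
  proof -
    have "C \<in> sets \<mu>" "A \<in> sets \<mu>"
      using that C(1) by (auto simp: sets)
    then show ?thesis
      by (simp add: N_def emeasure_density indicator_inter_arith[symmetric])
  qed
  have fin: "emeasure N UNIV < \<infinity>"
    using C(4) by (simp add: emN)
  have mC: "0 < measure N C"
    using C by (simp add: measure_def emN enn2real_positive_iff)
  \<comment> \<open>The tolerance is the whole mass of \<open>C\<close>: if \<open>F\<close> were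
    null, \<open>U - F\<close> would carry all of it.\<close>
  obtain F U where FU: "closed F" "open U" "F \<subseteq> C" "C \<subseteq> U" "measure N (U - F) < measure N C"
    using borel_closed_open_approx[OF setsN fin C(1) mC] by blast
  have "compact F"
    using comp FU(1) compact_Int_closed by force
  moreover have "emeasure \<mu> F \<noteq> 0"
  proof
    assume "emeasure \<mu> F = 0"
    then have "emeasure \<mu> (C - F) = emeasure \<mu> C"
      using C(1) FU(1) by (intro emeasure_Diff_null_set) (auto simp: null_sets_def sets)
    moreover have "C \<inter> (U - F) = C - F"
      using FU(4) by auto
    ultimately have "emeasure N (U - F) = emeasure N C"
      using C(1) FU(1,2) by (simp add: emN)
    with FU(5) show False
      by (simp add: measure_def)
  qed
  moreover have "emeasure \<mu> F \<le> emeasure \<mu> C"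
    using C(1) FU(3) by (intro emeasure_mono) (auto simp: sets)
  ultimately show ?thesis
    using C(2,4) FU(3) by (intro exI[of _ F]) (auto simp: zero_less_iff_neq_zero)
qed

text \<open>Zorn's lemma gives a maximal disjoint family of compact sets of finite positive measure.
  Were it countable, its complement would be null by maximality, and family and complement together
  would witness \<sigma>-finiteness.\<close>

lemma semifinite_not_sigma_finite_imp_uncountable_disjoint:
  fixes \<mu> :: "'a::metric_space measure"
  assumes comp: "compact (UNIV :: 'a set)" and sets: "sets \<mu> = sets borel"
    and sf: "semifinite \<mu>" and nsf: "\<not> sigma_finite_measure \<mu>"
  shows "\<exists>\<D>. uncountable \<D> \<and> disjoint \<D> \<and> (\<forall>K\<in>\<D>. compact K \<and> emeasure \<mu> K \<noteq> 0)"
proof -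
  define P where "P = {K. compact K \<and> 0 < emeasure \<mu> K \<and> emeasure \<mu> K < \<infinity>}"
  have "\<exists>M\<in>{\<D>. \<D> \<subseteq> P \<and> disjoint \<D>}. \<forall>X\<in>{\<D>. \<D> \<subseteq> P \<and> disjoint \<D>}. M \<subseteq> X \<longrightarrow> X = M"
  proof (rule subset_Zorn')
    fix \<C> assume "subset.chain {\<D>. \<D> \<subseteq> P \<and> disjoint \<D>} \<C>"
    then have \<C>: "\<And>\<D>. \<D> \<in> \<C> \<Longrightarrow> \<D> \<subseteq> P \<and> disjoint \<D>"
      "\<And>\<D> \<E>. \<D> \<in> \<C> \<Longrightarrow> \<E> \<in> \<C> \<Longrightarrow> \<D> \<subseteq> \<E> \<or> \<E> \<subseteq> \<D>"
      unfolding subset_chain_def by auto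
    have "disjoint (\<Union>\<C>)"
    proof (rule pairwiseI)
      fix K L assume "K \<in> \<Union>\<C>" "L \<in> \<Union>\<C>" "K \<noteq> L"
      moreover then obtain \<D> where "\<D> \<in> \<C>" "K \<in> \<D>" "L \<in> \<D>"
        using \<C>(2) by blast
      ultimately show "disjnt K L"
        using \<C>(1) by (meson pairwiseD)
    qed
    then show "\<Union>\<C> \<in> {\<D>. \<D> \<subseteq> P \<and> disjoint \<D>}"
      using \<C>(1) by blast
  qed
  then obtain \<D> where "\<D> \<in> {\<D>. \<D> \<subseteq> P \<and> disjoint \<D>}"
    and max: "\<forall>\<E>\<in>{\<D>. \<D> \<subseteq> P \<and> disjoint \<D>}. \<D> \<subseteq> \<E> \<longrightarrow> \<E> = \<D>"
    by (rule bexE)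
  then have \<D>: "\<D> \<subseteq> P" "disjoint \<D>"
    by simp_all
  have "uncountable \<D>"
  proof
    assume cnt: "countable \<D>"
    have Dm: "K \<in> sets \<mu>" if "K \<in> \<D>" for K
      using \<D>(1) that by (auto simp: P_def sets borel_compact)
    have Cm: "- \<Union>\<D> \<in> sets borel"
      using Dm cnt unfolding sets by (intro borel_comp sets.countable_Union) auto
    have "emeasure \<mu> (- \<Union>\<D>) = 0"
    proof (rule ccontr)
      assume "emeasure \<mu> (- \<Union>\<D>) \<noteq> 0"
      with Cm obtain K where K: "K \<in> P" "K \<subseteq> - \<Union>\<D>"
        using semifinite_imp_compact_subset[OF comp sets sf, of "- \<Union>\<D>"]
        by (auto simp: P_def zero_less_iff_neq_zero)
      \<comment> \<open>Maximality puts \<open>K\<close> into the family whose union it misses, so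
        \<open>K\<close> is empty, contradicting its positive measure.\<close>
      have "insert K \<D> = \<D>"
        using K \<D> by (intro max[rule_format]) (auto simp: pairwise_insert disjnt_def)
      then have "K = {}"
        using K(2) by blast
      then show False
        using K(1) by (simp add: P_def)
    qed
    then have "\<forall>K\<in>insert (- \<Union>\<D>) \<D>. emeasure \<mu> K \<noteq> \<infinity>"
      using \<D>(1) by (auto simp: P_def)
    moreover have "insert (- \<Union>\<D>) \<D> \<subseteq> sets \<mu>"
      using Dm Cm sets by blast
    moreover have "\<Union> (insert (- \<Union>\<D>) \<D>) = space \<mu>"
      using sets_eq_imp_space_eq[OF sets] by simp
    moreover have "countable (insert (- \<Union>\<D>) \<D>)"
      using cnt by simp
    ultimately have "sigma_finite_measure \<mu>"
      by (intro sigma_finite_measure.intro) blast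
    with nsf show False ..
  qed
  moreover have "compact K \<and> emeasure \<mu> K \<noteq> 0" if "K \<in> \<D>" for K
    using \<D>(1) that unfolding P_def by (metis (mono_tags, lifting) less_irrefl mem_Collect_eq subsetD)
  ultimately show ?thesis
    using \<D>(2) by blast
qed

section \<open>A Cantor scheme of compact sets\<close>

definition cyl :: "'b list \<Rightarrow> (nat \<Rightarrow> 'b) set" where
  "cyl s = {x. \<forall>i<length s. x i = s ! i}"

lemma cylD: "x \<in> cyl s \<Longrightarrow> i < length s \<Longrightarrow> x i = s ! i"
  by (simp add: cyl_def)

lemma cyl_map_upt [simp]: "y \<in> cyl (map x [0..<n]) \<longleftrightarrow> (\<forall>i<n. y i = x i)"
  by (simp add: cyl_def)

text \<open>A basic open set of the product restricts only finitely many coordinates, so a long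
  enough initial segment of \<open>x\<close> settles them all.\<close>

lemma open_contains_cyl:
  fixes x :: "nat \<Rightarrow> 'b::topological_space"
  assumes "open W" "x \<in> W"
  shows "\<exists>n. cyl (map x [0..<n]) \<subseteq> W"
proof -
  obtain U where U: "finite {i. U i \<noteq> UNIV}" "\<And>i. x i \<in> U i" "Pi\<^sub>E UNIV U \<subseteq> W"
    using assms unfolding open_fun_def openin_product_topology_alt by fastforce
  obtain n where n: "\<And>i. U i \<noteq> UNIV \<Longrightarrow> i < n"
    using U(1) finite_nat_set_iff_bounded by auto
  have "y \<in> W" if "y \<in> cyl (map x [0..<n])" for y
  proof -
    have "y i \<in> U i" for i
      using that U(2)[of i] n[of i] by (cases "i < n") auto
    then show ?thesis
      using U(3) by auto
  qed
  then show ?thesis by blast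
qed

lemma vietoris_continuous_upper:
  fixes f :: "(nat \<Rightarrow> nat) \<Rightarrow> 'a::topological_space set"
  assumes f: "continuous_map euclidean vietoris f" and U: "open U" "f x \<subseteq> U"
  shows "\<exists>n. \<forall>y\<in>cyl (map x [0..<n]). f y \<subseteq> U"
proof -
  have "openin vietoris {K. compact K \<and> K \<subseteq> U}"
    unfolding vietoris_def using U(1) by (intro topology_generated_by_Basis) auto
  then have "open {y. f y \<in> {K. compact K \<and> K \<subseteq> U}}"
    using openin_continuous_map_preimage[OF f] by fastforce
  moreover have "compact (f x)"
    using continuous_map_image_subset_topspace[OF f] by auto
  ultimately obtain n where "cyl (map x [0..<n]) \<subseteq> {y. f y \<in> {K. compact K \<and> K \<subseteq> U}}"
    using open_contains_cyl[of "{y. f y \<in> {K. compact K \<and> K \<subseteq> U}}" x] U(2) by auto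
  then show ?thesis
    by blast
qed

text \<open>There are only countably many finite words, so the points of \<open>X\<close> having
  some cylinder that meets \<open>X\<close> in a countable set are countably many. Uncountably many
  condensation points remain.\<close>

lemma uncountable_two_condensation_points:
  fixes X :: "(nat \<Rightarrow> 'b::countable) set"
  assumes "uncountable X"
  shows "\<exists>x\<in>X. \<exists>y\<in>X. x \<noteq> y \<and> (\<forall>n. uncountable (X \<inter> cyl (map x [0..<n]))) \<and>
    (\<forall>n. uncountable (X \<inter> cyl (map y [0..<n])))"
proof -
  define Y where "Y = {x\<in>X. \<forall>n. uncountable (X \<inter> cyl (map x [0..<n]))}"
  have "countable (\<Union>s\<in>{s. countable (X \<inter> cyl s)}. X \<inter> cyl s)"
    by (rule countable_UN) auto
  moreover have "X - Y \<subseteq> (\<Union>s\<in>{s. countable (X \<inter> cyl s)}. X \<inter> cyl s)"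
  proof
    fix x assume "x \<in> X - Y"
    then obtain n where "countable (X \<inter> cyl (map x [0..<n]))" "x \<in> X"
      by (auto simp: Y_def)
    then show "x \<in> (\<Union>s\<in>{s. countable (X \<inter> cyl s)}. X \<inter> cyl s)"
      by (intro UN_I[of "map x [0..<n]"]) auto
  qed
  ultimately have "countable (X - Y)"
    by (rule countable_subset[rotated])
  then have "uncountable Y"
    using assms countable_Un[of "X - Y" Y] countable_subset[of X "X - Y \<union> Y"] by blast
  then obtain x where x: "x \<in> Y"
    by fastforce
  have "uncountable (Y - {x})"
    using \<open>uncountable Y\<close> by (simp add: uncountable_minus_countable)
  then obtain y where y: "y \<in> Y" "y \<noteq> x"
    by (metis Diff_iff countable_empty ex_in_conv insertI1)
  with x show ?thesis
    by (auto simp: Y_def)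
qed

text \<open>Two condensation points have disjoint compact values, which lie in disjoint open sets;
  continuity extends this to cylinders. The values are disjoint at all points of the two cylinders,
  not only at those of \<open>X\<close>, so limits of branches may leave \<open>X\<close>.\<close>

lemma split_cyl:
  fixes f :: "(nat \<Rightarrow> nat) \<Rightarrow> 'a::metric_space set"
  assumes f: "continuous_map euclidean vietoris f"
    and disj: "\<And>x y. x \<in> X \<Longrightarrow> y \<in> X \<Longrightarrow> x \<noteq> y \<Longrightarrow> f x \<inter> f y = {}"
    and unc: "uncountable (X \<inter> cyl s)"
  shows "\<exists>t u. (\<forall>v\<in>{t, u}. uncountable (X \<inter> cyl v) \<and> cyl v \<subseteq> cyl s \<and> length s < length v) \<and>
    (\<forall>x\<in>cyl t. \<forall>y\<in>cyl u. f x \<inter> f y = {})"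
proof -
  obtain x y where xy: "x \<in> X \<inter> cyl s" "y \<in> X \<inter> cyl s" "x \<noteq> y"
    "\<And>n. uncountable (X \<inter> cyl s \<inter> cyl (map x [0..<n]))"
    "\<And>n. uncountable (X \<inter> cyl s \<inter> cyl (map y [0..<n]))"
    using uncountable_two_condensation_points[OF unc] by blast
  have "compact (f x)" "compact (f y)"
    using continuous_map_image_subset_topspace[OF f] by auto
  moreover have "disjnt (f x) (f y)"
    using disj xy by (simp add: disjnt_def)
  ultimately obtain U V where UV: "open U" "open V" "f x \<subseteq> U" "f y \<subseteq> V" "U \<inter> V = {}"
    using Hausdorff_space_compact_separation[of euclidean "f x" "f y"]
    by (metis Hausdorff_space_euclidean compactin_euclidean_iff disjnt_def open_openin)
  obtain m n where mn: "\<And>z. z \<in> cyl (map x [0..<m]) \<Longrightarrow> f z \<subseteq> U"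
    "\<And>z. z \<in> cyl (map y [0..<n]) \<Longrightarrow> f z \<subseteq> V"
    using vietoris_continuous_upper[OF f] UV by meson
  \<comment> \<open>Beyond \<open>m\<close> and \<open>n\<close> the values stay in \<open>U\<close>
    and \<open>V\<close>; exceeding \<open>length s\<close> makes the new words proper extensions of
    \<open>s\<close>.\<close>
  define k where "k = max (Suc (length s)) (max m n)"
  have sub: "cyl (map z [0..<k]) \<subseteq> cyl s" if "z \<in> cyl s" for z
    using that by (auto simp: cyl_def k_def)
  have "uncountable (X \<inter> cyl (map z [0..<k]))" if "z = x \<or> z = y" for z
    using that xy(4,5)[of k]
      countable_subset[of "X \<inter> cyl s \<inter> cyl (map z [0..<k])" "X \<inter> cyl (map z [0..<k])"]
    by blast
  moreover have "f a \<inter> f b = {}" if "a \<in> cyl (map x [0..<k])" "b \<in> cyl (map y [0..<k])" for a b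
  proof -
    have "f a \<subseteq> U" "f b \<subseteq> V"
      using that by (auto simp: k_def intro!: mn)
    then show ?thesis
      using UV(5) by blast
  qed
  ultimately show ?thesis
    using sub xy(1,2)
    by (intro exI[of _ "map x [0..<k]"] exI[of _ "map y [0..<k]"]) (auto simp: k_def)
qed

text \<open>Repeated splitting yields a binary tree of words. Each branch \<open>x\<close>
  determines a point \<open>g x\<close> of the Baire space, and \<open>f (g x)\<close> serves as
  \<open>K x\<close>. The last property is upper semicontinuity of \<open>K\<close>.\<close>

lemma cantor_family:
  fixes f :: "(nat \<Rightarrow> nat) \<Rightarrow> 'a::metric_space set"
  assumes f: "continuous_map euclidean vietoris f"
    and disj: "\<And>x y. x \<in> X \<Longrightarrow> y \<in> X \<Longrightarrow> x \<noteq> y \<Longrightarrow> f x \<inter> f y = {}"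
    and unc: "uncountable X"
  obtains K :: "(nat \<Rightarrow> bool) \<Rightarrow> 'a set"
  where "\<And>x. K x \<in> range f" "\<And>x y. x \<noteq> y \<Longrightarrow> K x \<inter> K y = {}"
    "\<And>x U. open U \<Longrightarrow> K x \<subseteq> U \<Longrightarrow> \<exists>n. \<forall>y\<in>cyl (map x [0..<n]). K y \<subseteq> U"
proof -
  obtain sp where sp: "\<And>s b. uncountable (X \<inter> cyl s) \<Longrightarrow>
      uncountable (X \<inter> cyl (sp s b)) \<and> cyl (sp s b) \<subseteq> cyl s \<and> length s < length (sp s b)"
    "\<And>s x y. uncountable (X \<inter> cyl s) \<Longrightarrow> x \<in> cyl (sp s True) \<Longrightarrow> y \<in> cyl (sp s False) \<Longrightarrow>
      f x \<inter> f y = {}"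
  proof -
    have "\<exists>t u. uncountable (X \<inter> cyl s) \<longrightarrow>
        (\<forall>v\<in>{t, u}. uncountable (X \<inter> cyl v) \<and> cyl v \<subseteq> cyl s \<and> length s < length v) \<and>
        (\<forall>x\<in>cyl t. \<forall>y\<in>cyl u. f x \<inter> f y = {})" for s
      using split_cyl[OF f disj, of X s] by blast
    then obtain t u where "\<And>s. uncountable (X \<inter> cyl s) \<longrightarrow>
        (\<forall>v\<in>{t s, u s}. uncountable (X \<inter> cyl v) \<and> cyl v \<subseteq> cyl s \<and> length s < length v) \<and>
        (\<forall>x\<in>cyl (t s). \<forall>y\<in>cyl (u s). f x \<inter> f y = {})"
      by metis
    then show ?thesis
      by (intro that[of "\<lambda>s b. if b then t s else u s"]) auto
  qed
  \<comment> \<open>\<open>c x n\<close> is the word reached from the root by following the first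
    \<open>n\<close> bits of \<open>x\<close>.\<close>
  define c where "c x n = rec_nat [] (\<lambda>k s. sp s (x k)) n" for x n
  have c0: "c x 0 = []" and cS: "c x (Suc n) = sp (c x n) (x n)" for x n
    by (simp_all add: c_def)
  have big: "uncountable (X \<inter> cyl (c x n))" for x n
    by (induction n) (use unc sp(1) in \<open>auto simp: c0 cS cyl_def[of "[]"]\<close>)
  have dec: "cyl (c x n) \<subseteq> cyl (c x m)" if "m \<le> n" for x m n
    using that by (rule lift_Suc_antimono_le[rotated]) (use sp(1)[OF big] in \<open>simp add: cS\<close>)
  have len: "n \<le> length (c x n)" for x n
  proof (induction n)
    case (Suc n)
    then show ?case
      using sp(1)[OF big[of x n], of "x n"] by (simp add: cS)
  qed simp
  have c_cong: "c x n = c y n" if "\<And>i. i < n \<Longrightarrow> x i = y i" for x y n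
    using that by (induction n) (auto simp: c0 cS)
  have "\<exists>z. \<forall>n. z \<in> cyl (c x n)" for x
  proof -
    have "\<forall>n. \<exists>w. w \<in> cyl (c x n)"
      using big[of x] by (metis Int_emptyI countable_empty)
    then obtain w where w: "\<And>n. w n \<in> cyl (c x n)"
      by metis
    \<comment> \<open>The diagonal \<open>w (Suc k) k\<close> is a point common to all the
      cylinders: the word \<open>c x (Suc k)\<close> has length at least \<open>Suc k\<close>, so it
      already fixes coordinate \<open>k\<close>.\<close>
    have "w (Suc k) k = c x n ! k" if "k < length (c x n)" for k n
    proof (cases "Suc k \<le> n")
      case True
      then have "w n \<in> cyl (c x (Suc k))" "w (Suc k) \<in> cyl (c x (Suc k))" "w n \<in> cyl (c x n)"
        using w dec by blast+
      moreover have "k < length (c x (Suc k))"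
        using len[of "Suc k" x] by simp
      ultimately have "w (Suc k) k = c x (Suc k) ! k" "w n k = c x (Suc k) ! k" "w n k = c x n ! k"
        using that by (blast intro: cylD)+
      then show ?thesis
        by simp
    next
      case False
      then have "w (Suc k) \<in> cyl (c x n)"
        using w dec[of n "Suc k" x] by auto
      then show ?thesis
        using that by (simp add: cyl_def)
    qed
    then show ?thesis
      by (intro exI[of _ "\<lambda>k. w (Suc k) k"]) (simp add: cyl_def)
  qed
  then obtain g where g: "\<And>x n. g x \<in> cyl (c x n)"
    by metis
  show thesis
  proof
    show "f (g x) \<in> range f" for x
      by simp
    show "f (g x) \<inter> f (g y) = {}" if "x \<noteq> y" for x y
    proof -
      have "\<exists>n. x n \<noteq> y n"
        using that by (simp add: fun_eq_iff)
      then obtain n where n: "x n \<noteq> y n" "\<And>i. i < n \<Longrightarrow> x i = y i"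
        using exists_least_iff[of "\<lambda>n. x n \<noteq> y n"] by blast
      have c: "c x n = c y n"
        by (rule c_cong) (rule n(2))
      note sp2 = sp(2)[OF big[of x n]]
      have gx: "g x \<in> cyl (sp (c x n) (x n))" and gy: "g y \<in> cyl (sp (c x n) (y n))"
        using g[of x "Suc n"] g[of y "Suc n"] by (simp_all only: cS c)
      show ?thesis
      \<comment> \<open>At the first differing bit the branches separate; \<open>sp2\<close> expects
        the \<open>True\<close> branch first, so the other case is obtained by symmetry.\<close>
      proof (cases "x n")
        case True
        then show ?thesis
          using n(1) gx gy by (intro sp2) simp_all
      next
        case False
        then have "f (g y) \<inter> f (g x) = {}"
          using n(1) gx gy by (intro sp2) simp_all
        then show ?thesis
          by (simp only: Int_commute)
      qed
    qed
    show "\<exists>n. \<forall>y\<in>cyl (map x [0..<n]). f (g y) \<subseteq> U" if U: "open U" "f (g x) \<subseteq> U" for x U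
    proof -
      obtain n where n: "\<And>y. y \<in> cyl (map (g x) [0..<n]) \<Longrightarrow> f y \<subseteq> U"
        using vietoris_continuous_upper[OF f U(1), of "g x"] U(2) by metis
      \<comment> \<open>The first \<open>n\<close> bits determine a word of length at least
        \<open>n\<close>, hence the first \<open>n\<close> entries of the limit: \<open>g\<close> is
        continuous.\<close>
      have gi: "g y i = g x i" if "y \<in> cyl (map x [0..<n])" "i < n" for y i
        using that c_cong[of n y x] g[of y n] g[of x n] len[of n x] by (simp add: cyl_def)
      have "f (g y) \<subseteq> U" if "y \<in> cyl (map x [0..<n])" for y
        by (rule n) (use gi[OF that] in simp)
      then show ?thesis
        by blast
    qed
  qed
qed

section \<open>A countable dense set of parameters and a category argument\<close>

lemma countable_eventually_False: "countable {x :: nat \<Rightarrow> bool. \<exists>n. \<forall>i\<ge>n. \<not> x i}"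
proof (rule countable_subset)
  \<comment> \<open>A finite list codes the sequence that continues it with
    \<open>False\<close>.\<close>
  show "{x :: nat \<Rightarrow> bool. \<exists>n. \<forall>i\<ge>n. \<not> x i} \<subseteq> range (\<lambda>s i. i < length s \<and> s ! i)"
  proof clarify
    fix x :: "nat \<Rightarrow> bool" and n assume "\<forall>i\<ge>n. \<not> x i"
    then show "x \<in> range (\<lambda>s i. i < length s \<and> s ! i)"
      by (intro range_eqI[of _ _ "map x [0..<n]"] ext) (metis diff_zero length_map length_upt not_le
        nth_map_upt add_0)
  qed
qed auto

text \<open>
  A Baire category argument by fusion: switching on one far coordinate of an eventually false
  sequence keeps its \<open>K\<close> inside a given open set, and infinitely many switches force the limit to
  be true infinitely often.
\<close>

lemma gdelta_contains_generic:
  fixes K :: "(nat \<Rightarrow> bool) \<Rightarrow> 'a::topological_space set"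
  assumes K: "\<And>x U. open U \<Longrightarrow> K x \<subseteq> U \<Longrightarrow> \<exists>n. \<forall>y\<in>cyl (map x [0..<n]). K y \<subseteq> U"
    and G: "gdelta_in euclidean G"
    and sub: "\<And>x. \<exists>n. \<forall>i\<ge>n. \<not> x i \<Longrightarrow> K x \<subseteq> G"
  shows "\<exists>x. (\<forall>n. \<exists>i\<ge>n. x i) \<and> K x \<subseteq> G"
proof -
  obtain C :: "nat \<Rightarrow> 'a set" where C: "\<And>n. open (C n)" "\<Inter> (range C) = G"
    using G unfolding gdelta_in_descending by auto
  \<comment> \<open>A state is a sequence together with the length of its frozen prefix. Step
    \<open>n\<close> extends the prefix, adds a true entry to it and forces
    \<open>K y \<subseteq> C n\<close> on its cylinder.\<close>
  define Q where "Q n p q \<longleftrightarrow> snd p < snd q \<and> (\<forall>i<snd p. fst q i = fst p i) \<and>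
      (\<exists>i\<ge>snd p. i < snd q \<and> fst q i) \<and> (\<forall>y\<in>cyl (map (fst q) [0..<snd q]). K y \<subseteq> C n)"
    for n and p q :: "(nat \<Rightarrow> bool) \<times> nat"
  have "\<exists>P. \<forall>n. (\<exists>l. \<forall>i\<ge>l. \<not> fst (P n) i) \<and> Q n (P n) (P (Suc n))"
  proof (rule dependent_nat_choice)
    show "\<exists>p::(nat \<Rightarrow> bool) \<times> nat. \<exists>l. \<forall>i\<ge>l. \<not> fst p i"
      by (intro exI[of _ "(\<lambda>_. False, 0)"]) simp
  next
    fix p :: "(nat \<Rightarrow> bool) \<times> nat" and n
    assume fin: "\<exists>l. \<forall>i\<ge>l. \<not> fst p i"
    obtain x m where p: "p = (x, m)" by force
    obtain l where l: "\<And>i. i \<ge> l \<Longrightarrow> \<not> x i"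
      using fin p by auto
    have "K x \<subseteq> C n"
      using sub[of x] l C(2) by blast
    then obtain k where k: "\<And>y. y \<in> cyl (map x [0..<k]) \<Longrightarrow> K y \<subseteq> C n"
      using K[OF C(1)] by blast
    define j where "j = max l (max k m)"
    have "K y \<subseteq> C n" if "y \<in> cyl (map (x(j := True)) [0..<Suc j])" for y
      using that by (intro k) (auto simp: j_def simp del: upt_Suc)
    then have "Q n p (x(j := True), Suc j)"
      unfolding Q_def p by (auto simp: j_def simp del: upt_Suc intro!: exI[of _ j])
    moreover have "\<exists>l. \<forall>i\<ge>l. \<not> fst (x(j := True), Suc j) i"
      using l by (intro exI[of _ "Suc j"]) (auto simp: j_def)
    ultimately show "\<exists>q. (\<exists>l. \<forall>i\<ge>l. \<not> fst q i) \<and> Q n p q"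
      by blast
  qed
  then obtain P where "\<And>n. Q n (P n) (P (Suc n))"
    by blast
  then have P: "\<And>n. snd (P n) < snd (P (Suc n))"
      "\<And>n i. i < snd (P n) \<Longrightarrow> fst (P (Suc n)) i = fst (P n) i"
      "\<And>n. \<exists>i\<ge>snd (P n). i < snd (P (Suc n)) \<and> fst (P (Suc n)) i"
      "\<And>n y. y \<in> cyl (map (fst (P (Suc n))) [0..<snd (P (Suc n))]) \<Longrightarrow> K y \<subseteq> C n"
    unfolding Q_def by blast+
  have sm: "strict_mono (\<lambda>n. snd (P n))"
    using P(1) by (simp add: strict_mono_Suc_iff)
  then have ge: "n \<le> snd (P n)" for n
    using strict_mono_imp_increasing by blast
  have agree: "fst (P n) i = fst (P m) i" if "m \<le> n" "i < snd (P m)" for m n i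
    using that
  proof (induction n rule: dec_induct)
    case (step n)
    then have "i < snd (P n)"
      using sm by (meson less_le_trans strict_mono_less_eq)
    then show ?case
      using step P(2) by simp
  qed simp
  \<comment> \<open>The prefix frozen at stage \<open>Suc i\<close> has length at least
    \<open>Suc i\<close>, so entry \<open>i\<close> is final there.\<close>
  define x where "x i = fst (P (Suc i)) i" for i
  have x: "x i = fst (P n) i" if "i < snd (P n)" for n i
    using agree[of n "Suc i" i] agree[of "Suc i" n i] that ge[of "Suc i"]
    by (cases "n \<le> Suc i") (auto simp: x_def)
  have "\<exists>i\<ge>n. x i" for n
  proof -
    obtain i where "i \<ge> snd (P n)" "i < snd (P (Suc n))" "fst (P (Suc n)) i"
      using P(3) by blast
    then show ?thesis
      using x ge[of n] by (intro exI[of _ i]) auto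
  qed
  moreover have "K x \<subseteq> C n" for n
    by (rule P(4)) (simp add: x)
  then have "K x \<subseteq> G"
    using C(2) by blast
  ultimately show ?thesis by blast
qed

section \<open>The set \<open>M\<close> and the restriction of \<open>\<mu>\<close> to its
  complement\<close>

theorem theorem1p1:
  fixes \<mu> :: "'a::metric_space measure"
  assumes "compact (UNIV :: 'a set)"
    and "sets \<mu> = sets borel"
    and "\<And>x. emeasure \<mu> {x} = 0"
    and "semifinite \<mu>"
    and "coanalytic_in vietoris {K. compact K \<and> emeasure \<mu> K = 0}"
    and "\<not> sigma_finite_measure \<mu>"
  shows "\<exists>M. gdelta_sigma_in euclidean M \<and>
    (\<nexists>G. gdelta_in euclidean G \<and> M \<subseteq> G \<and> emeasure \<mu> (G - M) = 0) \<and>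
    (\<exists>\<mu>'. sets \<mu>' = sets borel \<and> semifinite \<mu>' \<and> absolutely_continuous \<mu> \<mu>' \<and>
       emeasure \<mu>' M = 0 \<and>
       (\<nexists>G. gdelta_in euclidean G \<and> M \<subseteq> G \<and> emeasure \<mu>' G = 0))"
proof -
  note sets = assms(2)
  obtain \<D> where \<D>: "uncountable \<D>" "disjoint \<D>"
    "\<And>K. K \<in> \<D> \<Longrightarrow> compact K \<and> emeasure \<mu> K \<noteq> 0"
    using semifinite_not_sigma_finite_imp_uncountable_disjoint[OF assms(1,2,4,6)] by blast
  define A where "A = {K. compact K \<and> emeasure \<mu> K \<noteq> 0}"
  have "topspace vietoris - {K. compact K \<and> emeasure \<mu> K = 0} = A"
    by (auto simp: A_def)
  then have "analytic_in vietoris A"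
    using assms(5) by (simp add: coanalytic_in_def)
  moreover have "\<D> \<subseteq> A"
    using \<D>(3) by (auto simp: A_def)
  moreover have "\<D> \<noteq> {}"
    using \<D>(1) by auto
  ultimately obtain f :: "(nat \<Rightarrow> nat) \<Rightarrow> 'a set"
    where f: "continuous_map euclidean vietoris f" "range f = A"
    unfolding analytic_in_def by auto
  \<comment> \<open>One code is chosen for each member of \<open>\<D>\<close>, so distinct points of
    \<open>X\<close> have disjoint values.\<close>
  define X where "X = inv f ` \<D>"
  have finv: "f (inv f K) = K" if "K \<in> \<D>" for K
    using that \<open>\<D> \<subseteq> A\<close> unfolding f(2)[symmetric] by (intro f_inv_into_f[of K f UNIV]) blast
  have "f ` X = \<D>"
    using finv by (force simp: X_def)
  then have Xunc: "uncountable X"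
    using \<D>(1) by auto
  have Xdisj: "f x \<inter> f y = {}" if "x \<in> X" "y \<in> X" "x \<noteq> y" for x y
  proof -
    obtain K L where "K \<in> \<D>" "L \<in> \<D>" "x = inv f K" "y = inv f L"
      using \<open>x \<in> X\<close> \<open>y \<in> X\<close> unfolding X_def by blast
    then show ?thesis
      using \<open>x \<noteq> y\<close> pairwiseD[OF \<D>(2), of K L] finv by (auto simp: disjnt_def)
  qed
  obtain K :: "(nat \<Rightarrow> bool) \<Rightarrow> 'a set"
    where K: "\<And>x. K x \<in> range f" "\<And>x y. x \<noteq> y \<Longrightarrow> K x \<inter> K y = {}"
    "\<And>x U. open U \<Longrightarrow> K x \<subseteq> U \<Longrightarrow> \<exists>n. \<forall>y\<in>cyl (map x [0..<n]). K y \<subseteq> U"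
    using cantor_family[OF f(1) Xdisj Xunc] by blast
  have Kc: "compact (K x)" and Kpos: "emeasure \<mu> (K x) \<noteq> 0" for x
    using K(1)[of x] f(2) by (auto simp: A_def)
  define D where "D = {x :: nat \<Rightarrow> bool. \<exists>n. \<forall>i\<ge>n. \<not> x i}"
  have cD: "countable D"
    using countable_eventually_False by (simp add: D_def)
  define M where "M = (\<Union>x\<in>D. K x)"
  have Mb: "M \<in> sets borel"
    unfolding M_def using cD Kc by (intro sets.countable_UN') (auto intro: borel_compact)
  have gd: "gdelta_in euclidean (K x)" for x
    using Kc by (intro closed_imp_gdelta_in) (auto simp: metrizable_space_euclidean compact_imp_closed)
  have gds: "gdelta_sigma_in euclidean M"
    unfolding gdelta_sigma_in_def union_of_def M_def using cD gd
    by (intro exI[of _ "K ` D"]) auto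
  \<comment> \<open>This serves both claims. The generic \<open>x\<close> is true infinitely often,
    hence lies outside \<open>D\<close>, so \<open>K x\<close> is disjoint from \<open>M\<close> and
    contained in \<open>G\<close>.\<close>
  have pos: "emeasure \<mu> (G - M) \<noteq> 0" if G: "gdelta_in euclidean G" "M \<subseteq> G" for G
  proof -
    have "K x \<subseteq> G" if "\<exists>n. \<forall>i\<ge>n. \<not> x i" for x
      using that G(2) by (auto simp: M_def D_def)
    then obtain x where x: "\<forall>n. \<exists>i\<ge>n. x i" "K x \<subseteq> G"
      using gdelta_contains_generic[OF K(3) G(1)] by blast
    have "x \<notin> D"
      using x(1) by (auto simp: D_def)
    then have "K x \<inter> K y = {}" if "y \<in> D" for y
      using that by (intro K(2)) auto
    then have "K x \<inter> M = {}"
      by (auto simp: M_def)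
    moreover have "G \<in> sets borel"
      using G(1) by (auto simp: gdelta_in_descending)
    ultimately have "emeasure \<mu> (K x) \<le> emeasure \<mu> (G - M)"
      using x(2) Mb by (intro emeasure_mono) (auto simp: sets)
    then show ?thesis
      using Kpos[of x] by auto
  qed
  define \<nu> where "\<nu> = density \<mu> (indicator (- M))"
  have em: "emeasure \<nu> B = emeasure \<mu> (B - M)" if "B \<in> sets borel" for B
  proof -
    have "- M \<in> sets \<mu>" "B \<in> sets \<mu>" "B \<inter> - M \<in> sets \<mu>"
      using that Mb by (auto simp: sets)
    then show ?thesis
      by (simp add: \<nu>_def emeasure_density indicator_inter_arith[symmetric] Int_commute Diff_eq)
  qed
  have sets\<nu>: "sets \<nu> = sets borel"
    by (simp add: \<nu>_def sets)
  moreover have "semifinite \<nu>"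
    unfolding semifinite_def
  proof (intro ballI impI)
    fix B assume B: "B \<in> sets \<nu>" "0 < emeasure \<nu> B"
    then have Bb: "B \<in> sets borel"
      by (simp add: sets\<nu>)
    \<comment> \<open>Choosing \<open>C\<close> inside \<open>B - M\<close> makes
      \<open>\<mu>\<close> and \<open>\<nu>\<close> agree on it.\<close>
    obtain C where C: "C \<in> sets borel" "C \<subseteq> B - M" "0 < emeasure \<mu> C" "emeasure \<mu> C < \<infinity>"
      using assms(4) B(2) Bb Mb unfolding semifinite_def sets em[OF Bb] by (meson sets.Diff)
    then have "C - M = C"
      by blast
    with C show "\<exists>C\<in>sets \<nu>. C \<subseteq> B \<and> 0 < emeasure \<nu> C \<and> emeasure \<nu> C < \<infinity>"
      by (intro bexI[of _ C]) (auto simp: em sets\<nu>)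
  qed
  moreover have "absolutely_continuous \<mu> \<nu>"
    unfolding \<nu>_def using Mb
    by (intro absolutely_continuousI_density borel_measurable_indicator) (simp add: sets)
  moreover have "emeasure \<nu> M = 0"
    by (simp add: em Mb)
  moreover have "emeasure \<nu> G \<noteq> 0" if "gdelta_in euclidean G" "M \<subseteq> G" for G
    using pos[OF that] that(1) by (subst em) (auto simp: gdelta_in_descending)
  ultimately show ?thesis
    using gds pos by blast
qed

end
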